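(* Let $P$ be the Markov operator on $L^2(\pi)$ of a Harris ergodic Markov chain with invariant density $\pi$, and suppose $P$ is non-negative and trace-class. Let $1=\lambda_0>\lambda_1\ge\lambda_2\ge\dots$ be its strictly positive eigenvalues $\{\lambda_i\}_{i=0}^{\kappa}$, $0\le\kappa\le\infty$, in decreasing order and counted with multiplicity (with $\lambda_1:=0$ if $\kappa=0$). For $k\in\mathbb{N}=\{1,2,\dots\}$ let $s_k=\sum_{i=0}^{\kappa}\lambda_i^k$, let $s_0=\infty$, and define $$u_k=(s_k-1)^{1/k},\qquad l_k=\frac{s_k-1}{s_{k-1}-1}\ \text{ (if } \kappa\ge 1).$$ Then, as $k\to\infty$, $u_k\downarrow\lambda_1$ (i.e. $u_k$ is non-increasing in $k$ and converges to $\lambda_1$); and if furthermore $\kappa\ge1$, then $l_k\uparrow\lambda_1$ (i.e. $l_k$ is non-decreasing in $k$ and converges to $\lambda_1$).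
   Context: $(S,\mathcal{U},\mu)$ is a $\sigma$-finite measure space with $\mathcal{U}$ countably generated, and $\pi:S\to[0,\infty)$ is a probability density with respect to $\mu$. The Markov chain on $S$ has a Markov transition density $p(u,\cdot)$, $u\in S$, with respect to $\mu$, for which $\pi$ is invariant. The chain is Harris ergodic, i.e. irreducible, aperiodic and Harris recurrent. $L^2(\pi)$ is the complex Hilbert space of functions $f:S\to\mathbb{C}$ with $\int_S|f|^2\pi\,d\mu<\infty$, with inner product $\langle f,g\rangle_\pi=\int_S f\overline{g}\,\pi\,d\mu$. The Markov operator is $Pf(u)=\int_S p(u,u')f(u')\,\mu(du')$. Non-negative means $\langle Pf,f\rangle_\pi\ge0$ for all $f$ (so $P$ is self-adjoint). Trace-class means compact with summable eigenvalues. The largest eigenvalue is $\lambda_0=1$ (constant eigenfunction), and Harris ergodicity implies $\lambda_1<1$. By the convention $s_0=\infty$, $l_1=0$. *)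

theory Defs
  imports "HOL-Probability.Probability"
begin

section \<open>Markov chains with a transition density\<close>

definition countably_generated :: "'a measure \<Rightarrow> bool" where
  "countably_generated M \<longleftrightarrow>
     (\<exists>G. countable G \<and> G \<subseteq> Pow (space M) \<and> sets M = sigma_sets (space M) G)"

definition probability_density :: "'a measure \<Rightarrow> ('a \<Rightarrow> real) \<Rightarrow> bool" where
  "probability_density M \<pi> \<longleftrightarrow>
     \<pi> \<in> borel_measurable M \<and> (\<forall>x\<in>space M. 0 \<le> \<pi> x) \<and> (\<integral>\<^sup>+x. ennreal (\<pi> x) \<partial>M) = 1"

definition transition_density :: "'a measure \<Rightarrow> ('a \<Rightarrow> 'a \<Rightarrow> real) \<Rightarrow> bool" where
  "transition_density M p \<longleftrightarrow>
     (\<lambda>(x, y). p x y) \<in> borel_measurable (M \<Otimes>\<^sub>M M) \<and>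
     (\<forall>x\<in>space M. probability_density M (p x))"

definition invariant_density :: "'a measure \<Rightarrow> ('a \<Rightarrow> 'a \<Rightarrow> real) \<Rightarrow> ('a \<Rightarrow> real) \<Rightarrow> bool" where
  "invariant_density M p \<pi> \<longleftrightarrow>
     probability_density M \<pi> \<and>
     (AE y in M. (\<integral>\<^sup>+x. ennreal (\<pi> x * p x y) \<partial>M) = ennreal (\<pi> y))"

definition transition_kernel :: "'a measure \<Rightarrow> ('a \<Rightarrow> 'a \<Rightarrow> real) \<Rightarrow> 'a \<Rightarrow> 'a measure" where
  "transition_kernel M p x = density M (\<lambda>y. ennreal (p x y))"

text \<open>Law of coordinate \<^term>\<open>n\<close> of the chain started at \<^term>\<open>x\<close>, given the coordinates before \<^term>\<open>n\<close>.\<close>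

definition chain_step ::
    "'a measure \<Rightarrow> ('a \<Rightarrow> 'a \<Rightarrow> real) \<Rightarrow> 'a \<Rightarrow> nat \<Rightarrow> (nat \<Rightarrow> 'a) \<Rightarrow> 'a measure" where
  "chain_step M p x n \<omega> = (if n = 0 then return M x else transition_kernel M p (\<omega> (n - 1)))"

text \<open>Law of the whole trajectory, a measure on \<^term>\<open>PiM UNIV (\<lambda>_::nat. M)\<close>, by the
  Ionescu-Tulcea construction.\<close>

definition path_law :: "'a measure \<Rightarrow> ('a \<Rightarrow> 'a \<Rightarrow> real) \<Rightarrow> 'a \<Rightarrow> (nat \<Rightarrow> 'a) measure" where
  "path_law M p x =
     projective_family.lim UNIV (Ionescu_Tulcea.CI (chain_step M p x) (\<lambda>_. M)) (\<lambda>_. M)"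

lemma Ionescu_Tulcea_chain_step:
  assumes M: "sigma_finite_measure M" and p: "transition_density M p" and x: "x \<in> space M"
  shows "Ionescu_Tulcea (chain_step M p x) (\<lambda>_. M)"
proof (rule Ionescu_Tulcea.intro)
  interpret sigma_finite_measure M by fact
  have pm [measurable]: "(\<lambda>(x, y). p x y) \<in> borel_measurable (M \<Otimes>\<^sub>M M)"
    and pd: "\<And>y. y \<in> space M \<Longrightarrow> probability_density M (p y)"
    using p by (auto simp: transition_density_def)
  have prob: "prob_space (transition_kernel M p y)" if "y \<in> space M" for y
    using pd[OF that] unfolding transition_kernel_def probability_density_def
    by (intro prob_spaceI) (auto simp: emeasure_density cong: nn_integral_cong)
  have ker: "transition_kernel M p \<in> measurable M (subprob_algebra M)"
  proof (rule measurable_subprob_algebra)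
    fix y assume y: "y \<in> space M"
    show "subprob_space (transition_kernel M p y)"
      using prob[OF y] by (rule prob_space_imp_subprob_space)
    show "sets (transition_kernel M p y) = sets M"
      by (simp add: transition_kernel_def)
  next
    fix A assume A [measurable]: "A \<in> sets M"
    have "(\<lambda>y. \<integral>\<^sup>+z. ennreal (p y z) * indicator A z \<partial>M) \<in> borel_measurable M"
      by measurable
    moreover have "emeasure (transition_kernel M p y) A = (\<integral>\<^sup>+z. ennreal (p y z) * indicator A z \<partial>M)"
      if "y \<in> space M" for y
      using pd[OF that] unfolding transition_kernel_def probability_density_def
      by (intro emeasure_density) auto
    ultimately show "(\<lambda>y. emeasure (transition_kernel M p y) A) \<in> borel_measurable M"
      by (simp cong: measurable_cong)
  qed
  show "chain_step M p x i \<in> measurable (PiM {0..<i} (\<lambda>_. M)) (subprob_algebra M)" for i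
  proof (cases "i = 0")
    case True
    have "return M x \<in> space (subprob_algebra M)"
      using measurable_space[OF return_measurable x] .
    then have "(\<lambda>\<omega>. return M x) \<in> measurable (PiM {0..<i} (\<lambda>_. M)) (subprob_algebra M)"
      by simp
    moreover have "chain_step M p x i = (\<lambda>\<omega>. return M x)"
      using True by (auto simp: chain_step_def)
    ultimately show ?thesis by simp
  next
    case False
    then have "chain_step M p x i = (\<lambda>\<omega>. transition_kernel M p (\<omega> (i - 1)))"
      by (auto simp: chain_step_def)
    moreover have "(\<lambda>\<omega>. \<omega> (i - 1)) \<in> measurable (PiM {0..<i} (\<lambda>_. M)) M"
      using False by (intro measurable_component_singleton) auto
    ultimately show ?thesis
      using ker by (auto intro: measurable_compose)
  qed
  show "prob_space (chain_step M p x i \<omega>)" if "\<omega> \<in> space (PiM {0..<i} (\<lambda>_. M))" for i \<omega>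
    using that x by (auto simp: chain_step_def space_PiM PiE_iff intro!: prob prob_space_return)
qed

section \<open>Harris ergodicity\<close>

definition irreducibility_measure :: "'a measure \<Rightarrow> ('a \<Rightarrow> 'a \<Rightarrow> real) \<Rightarrow> 'a measure \<Rightarrow> bool" where
  "irreducibility_measure M p \<phi> \<longleftrightarrow>
     sets \<phi> = sets M \<and> sigma_finite_measure \<phi> \<and> emeasure \<phi> (space M) \<noteq> 0 \<and>
     (\<forall>A\<in>sets M. emeasure \<phi> A > 0 \<longrightarrow>
        (\<forall>x\<in>space M. emeasure (path_law M p x)
            {\<omega> \<in> space (PiM UNIV (\<lambda>_. M)). \<exists>n\<ge>1. \<omega> n \<in> A} > 0))"

definition maximal_irreducibility_measure ::
    "'a measure \<Rightarrow> ('a \<Rightarrow> 'a \<Rightarrow> real) \<Rightarrow> 'a measure \<Rightarrow> bool" where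
  "maximal_irreducibility_measure M p \<psi> \<longleftrightarrow>
     irreducibility_measure M p \<psi> \<and>
     (\<forall>\<phi>. irreducibility_measure M p \<phi> \<longrightarrow> absolutely_continuous \<psi> \<phi>)"

definition irreducible_chain :: "'a measure \<Rightarrow> ('a \<Rightarrow> 'a \<Rightarrow> real) \<Rightarrow> bool" where
  "irreducible_chain M p \<longleftrightarrow> (\<exists>\<phi>. irreducibility_measure M p \<phi>)"

definition cyclic_decomposition ::
    "'a measure \<Rightarrow> ('a \<Rightarrow> 'a \<Rightarrow> real) \<Rightarrow> 'a measure \<Rightarrow> nat \<Rightarrow> (nat \<Rightarrow> 'a set) \<Rightarrow> bool" where
  "cyclic_decomposition M p \<psi> d D \<longleftrightarrow>
     (\<forall>i<d. D i \<in> sets M) \<and> disjoint_family_on D {..<d} \<and>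
     (\<forall>i<d. \<forall>x\<in>D i. emeasure (transition_kernel M p x) (D (Suc i mod d)) = 1) \<and>
     emeasure \<psi> (space M - (\<Union>i<d. D i)) = 0"

definition aperiodic_chain :: "'a measure \<Rightarrow> ('a \<Rightarrow> 'a \<Rightarrow> real) \<Rightarrow> bool" where
  "aperiodic_chain M p \<longleftrightarrow>
     (\<forall>\<psi>. maximal_irreducibility_measure M p \<psi> \<longrightarrow>
        \<not> (\<exists>d\<ge>2. \<exists>D. cyclic_decomposition M p \<psi> d D))"

definition harris_recurrent :: "'a measure \<Rightarrow> ('a \<Rightarrow> 'a \<Rightarrow> real) \<Rightarrow> bool" where
  "harris_recurrent M p \<longleftrightarrow>
     (\<exists>\<psi>. maximal_irreducibility_measure M p \<psi> \<and>
        (\<forall>A\<in>sets M. emeasure \<psi> A > 0 \<longrightarrow>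
           (\<forall>x\<in>space M. emeasure (path_law M p x)
               {\<omega> \<in> space (PiM UNIV (\<lambda>_. M)). \<exists>\<^sub>\<infinity>n. \<omega> n \<in> A} = 1)))"

definition harris_ergodic :: "'a measure \<Rightarrow> ('a \<Rightarrow> 'a \<Rightarrow> real) \<Rightarrow> bool" where
  "harris_ergodic M p \<longleftrightarrow> irreducible_chain M p \<and> aperiodic_chain M p \<and> harris_recurrent M p"

section \<open>The Markov operator on \<open>L\<^sup>2(\<pi>)\<close>\<close>

text \<open>Elements of \<open>L\<^sup>2(\<pi>)\<close> are represented by measurable functions; equality in \<open>L\<^sup>2(\<pi>)\<close> is equality
  almost everywhere with respect to \<^term>\<open>density M \<pi>\<close>.\<close>

definition L2 :: "'a measure \<Rightarrow> ('a \<Rightarrow> real) \<Rightarrow> ('a \<Rightarrow> complex) set" where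
  "L2 M \<pi> = {f \<in> borel_measurable M. integrable M (\<lambda>x. (cmod (f x))\<^sup>2 * \<pi> x)}"

definition L2_inner :: "'a measure \<Rightarrow> ('a \<Rightarrow> real) \<Rightarrow> ('a \<Rightarrow> complex) \<Rightarrow> ('a \<Rightarrow> complex) \<Rightarrow> complex" where
  "L2_inner M \<pi> f g = (\<integral>x. f x * cnj (g x) * complex_of_real (\<pi> x) \<partial>M)"

definition L2_norm :: "'a measure \<Rightarrow> ('a \<Rightarrow> real) \<Rightarrow> ('a \<Rightarrow> complex) \<Rightarrow> real" where
  "L2_norm M \<pi> f = sqrt (\<integral>x. (cmod (f x))\<^sup>2 * \<pi> x \<partial>M)"

definition L2_eq :: "'a measure \<Rightarrow> ('a \<Rightarrow> real) \<Rightarrow> ('a \<Rightarrow> complex) \<Rightarrow> ('a \<Rightarrow> complex) \<Rightarrow> bool" where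
  "L2_eq M \<pi> f g \<longleftrightarrow> (AE x in density M (\<lambda>x. ennreal (\<pi> x)). f x = g x)"

definition markov_op :: "'a measure \<Rightarrow> ('a \<Rightarrow> 'a \<Rightarrow> real) \<Rightarrow> ('a \<Rightarrow> complex) \<Rightarrow> 'a \<Rightarrow> complex" where
  "markov_op M p f u = (\<integral>v. complex_of_real (p u v) * f v \<partial>M)"

definition nonneg_op ::
    "'a measure \<Rightarrow> ('a \<Rightarrow> real) \<Rightarrow> (('a \<Rightarrow> complex) \<Rightarrow> 'a \<Rightarrow> complex) \<Rightarrow> bool" where
  "nonneg_op M \<pi> T \<longleftrightarrow> (\<forall>f\<in>L2 M \<pi>. L2_inner M \<pi> (T f) f \<in> \<real>\<^sub>\<ge>\<^sub>0)"

definition compact_op ::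
    "'a measure \<Rightarrow> ('a \<Rightarrow> real) \<Rightarrow> (('a \<Rightarrow> complex) \<Rightarrow> 'a \<Rightarrow> complex) \<Rightarrow> bool" where
  "compact_op M \<pi> T \<longleftrightarrow>
     (\<forall>f :: nat \<Rightarrow> 'a \<Rightarrow> complex. (\<forall>n. f n \<in> L2 M \<pi>) \<and> bounded (range (\<lambda>n. L2_norm M \<pi> (f n))) \<longrightarrow>
        (\<exists>g\<in>L2 M \<pi>. \<exists>r. strict_mono r \<and>
           (\<lambda>n. L2_norm M \<pi> (\<lambda>x. T (f (r n)) x - g x)) \<longlonglongrightarrow> 0))"

definition eigenspace ::
    "'a measure \<Rightarrow> ('a \<Rightarrow> real) \<Rightarrow> (('a \<Rightarrow> complex) \<Rightarrow> 'a \<Rightarrow> complex) \<Rightarrow> complex \<Rightarrow> ('a \<Rightarrow> complex) set" where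
  "eigenspace M \<pi> T c = {f \<in> L2 M \<pi>. L2_eq M \<pi> (T f) (\<lambda>x. c * f x)}"

definition L2_independent ::
    "'a measure \<Rightarrow> ('a \<Rightarrow> real) \<Rightarrow> nat \<Rightarrow> (nat \<Rightarrow> 'a \<Rightarrow> complex) \<Rightarrow> bool" where
  "L2_independent M \<pi> n f \<longleftrightarrow>
     (\<forall>a :: nat \<Rightarrow> complex. L2_eq M \<pi> (\<lambda>x. \<Sum>i<n. a i * f i x) (\<lambda>_. 0) \<longrightarrow> (\<forall>i<n. a i = 0))"

text \<open>The dimension of the eigenspace; \<^term>\<open>c\<close> is an eigenvalue iff it is nonzero.\<close>

definition eigenvalue_multiplicity ::
    "'a measure \<Rightarrow> ('a \<Rightarrow> real) \<Rightarrow> (('a \<Rightarrow> complex) \<Rightarrow> 'a \<Rightarrow> complex) \<Rightarrow> complex \<Rightarrow> enat" where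
  "eigenvalue_multiplicity M \<pi> T c =
     Sup {enat n | n. \<exists>f. (\<forall>i<n. f i \<in> eigenspace M \<pi> T c) \<and> L2_independent M \<pi> n f}"

definition trace_class_op ::
    "'a measure \<Rightarrow> ('a \<Rightarrow> real) \<Rightarrow> (('a \<Rightarrow> complex) \<Rightarrow> 'a \<Rightarrow> complex) \<Rightarrow> bool" where
  "trace_class_op M \<pi> T \<longleftrightarrow>
     compact_op M \<pi> T \<and>
     (\<Sum>\<^sub>\<infinity>c\<in>UNIV. ennreal_of_enat (eigenvalue_multiplicity M \<pi> T c) * ennreal (cmod c)) < \<infinity>"

section \<open>Positive eigenvalues and their power sums\<close>

text \<open>The eigenvalue indices are the \<^term>\<open>i\<close> with \<^term>\<open>enat i \<le> \<kappa>\<close>; values of \<open>lam\<close> beyond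
  \<^term>\<open>\<kappa>\<close> are irrelevant.\<close>

definition enumerates_positive_eigenvalues ::
    "'a measure \<Rightarrow> ('a \<Rightarrow> real) \<Rightarrow> (('a \<Rightarrow> complex) \<Rightarrow> 'a \<Rightarrow> complex) \<Rightarrow> enat \<Rightarrow> (nat \<Rightarrow> real) \<Rightarrow> bool" where
  "enumerates_positive_eigenvalues M \<pi> T \<kappa> lam \<longleftrightarrow>
     (\<forall>i. enat i \<le> \<kappa> \<longrightarrow> 0 < lam i) \<and>
     (\<forall>i j. i \<le> j \<and> enat j \<le> \<kappa> \<longrightarrow> lam j \<le> lam i) \<and>
     (\<forall>x>0. finite {i. enat i \<le> \<kappa> \<and> lam i = x} \<and>
        eigenvalue_multiplicity M \<pi> T (complex_of_real x) =
          enat (card {i. enat i \<le> \<kappa> \<and> lam i = x}))"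

definition lambda_one :: "enat \<Rightarrow> (nat \<Rightarrow> real) \<Rightarrow> real" where
  "lambda_one \<kappa> lam = (if \<kappa> = 0 then 0 else lam 1)"

definition power_sum :: "enat \<Rightarrow> (nat \<Rightarrow> real) \<Rightarrow> nat \<Rightarrow> ereal" where
  "power_sum \<kappa> lam k = (if k = 0 then \<infinity> else (\<Sum>\<^sub>\<infinity>i\<in>{i. enat i \<le> \<kappa>}. ereal (lam i ^ k)))"

definition upper_bound_seq :: "enat \<Rightarrow> (nat \<Rightarrow> real) \<Rightarrow> nat \<Rightarrow> real" where
  "upper_bound_seq \<kappa> lam k = root k (real_of_ereal (power_sum \<kappa> lam k - 1))"

text \<open>Extended division gives the value \<open>0\<close> at \<open>k = 1\<close>, where the denominator is infinite.\<close>

definition lower_bound_seq :: "enat \<Rightarrow> (nat \<Rightarrow> real) \<Rightarrow> nat \<Rightarrow> real" where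
  "lower_bound_seq \<kappa> lam k =
     real_of_ereal ((power_sum \<kappa> lam k - 1) / (power_sum \<kappa> lam (k - 1) - 1))"

end

theory Submission
  imports Defs
begin

text \<open>
  The constant function is an eigenfunction for the eigenvalue \<open>1\<close>. By invariance \<open>P\<close> contracts
  \<open>L\<^sup>1(\<pi>)\<close>, which contains \<open>L\<^sup>2(\<pi>)\<close>, so no positive eigenvalue exceeds \<open>1\<close> and \<open>\<lambda>\<^sub>0 = 1\<close>.
  Hence \<open>s\<^sub>k - 1\<close> is the power sum \<open>t\<^sub>k\<close> of the remaining eigenvalues; these are summable by the
  trace-class hypothesis. The \<open>k\<close>-th root of \<open>t\<^sub>k\<close> is an \<open>\<ell>\<^sup>k\<close>-norm, and the ratios
  \<open>t\<^sub>k / t\<^sub>k\<^sub>-\<^sub>1\<close> increase because \<open>k \<mapsto> t\<^sub>k\<close> is log-convex.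
\<close>

section \<open>Power sums of a summable family\<close>

text \<open>Instantiated below with the eigenvalues of index at least 1 and \<open>m\<close> = 1.
  The index set is abstract, so finite and infinite spectra are treated alike; \<open>a m\<close> is
  the maximum to be recovered from the power sums.\<close>

locale dominated_summable_family =
  fixes a :: "'i \<Rightarrow> real" and J :: "'i set" and m :: 'i
  assumes nonneg: "i \<in> J \<Longrightarrow> 0 \<le> a i"
    and summable: "a summable_on J"
    and m_in: "m \<in> J"
    and le_m: "i \<in> J \<Longrightarrow> a i \<le> a m"
    and m_pos: "0 < a m"
begin

definition t :: "nat \<Rightarrow> real" where
  "t k = (\<Sum>\<^sub>\<infinity>i\<in>J. a i ^ k)"

lemma power_Suc_summable: "(\<lambda>i. a i ^ Suc k) summable_on J"
proof (rule summable_on_comparison_test)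
  show "(\<lambda>i. a m ^ k * a i) summable_on J"
    by (intro summable_on_cmult_right summable)
  show "a i ^ Suc k \<le> a m ^ k * a i" if "i \<in> J" for i
    using nonneg[OF that] le_m[OF that]
    by (simp add: mult.commute[of "a i"] mult_right_mono power_mono)
  show "0 \<le> a i ^ Suc k" if "i \<in> J" for i
    using nonneg[OF that] by simp
qed

lemma power_summable: "1 \<le> k \<Longrightarrow> (\<lambda>i. a i ^ k) summable_on J"
  using power_Suc_summable[of "k - 1"] by simp

lemma power_le_t:
  assumes "1 \<le> k" "i \<in> J"
  shows "a i ^ k \<le> t k"
proof -
  have "infsum (\<lambda>i. a i ^ k) {i} \<le> infsum (\<lambda>i. a i ^ k) J"
    using assms nonneg by (intro infsum_mono2 power_summable) auto
  then show ?thesis by (simp add: t_def)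
qed

lemma t_pos: "1 \<le> k \<Longrightarrow> 0 < t k"
  using power_le_t[OF _ m_in, of k] m_pos by (meson less_le_trans zero_less_power)

text \<open>Termwise, \<open>j\<close> of the factors are replaced by a common upper bound. The
  bound \<open>c\<close> is left free because it is taken once as the k-th root of
  \<open>t k\<close> and otherwise as \<open>a m\<close>.\<close>

lemma t_add_le:
  assumes "1 \<le> k" and c: "\<And>i. i \<in> J \<Longrightarrow> a i \<le> c"
  shows "t (k + j) \<le> c ^ j * t k"
proof -
  have "(\<Sum>\<^sub>\<infinity>i\<in>J. a i ^ (k + j)) \<le> (\<Sum>\<^sub>\<infinity>i\<in>J. c ^ j * a i ^ k)"
  proof (rule infsum_mono)
    show "(\<lambda>i. a i ^ (k + j)) summable_on J"
      using assms by (intro power_summable) auto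
    show "(\<lambda>i. c ^ j * a i ^ k) summable_on J"
      using assms by (intro summable_on_cmult_right power_summable)
    show "a i ^ (k + j) \<le> c ^ j * a i ^ k" if "i \<in> J" for i
      using nonneg[OF that] c[OF that]
      by (simp add: power_add mult.commute mult_right_mono power_mono)
  qed
  then show ?thesis by (simp add: t_def infsum_cmult_right')
qed

section \<open>Roots of power sums\<close>

lemma root_t_antimono:
  assumes "1 \<le> k" "k \<le> l"
  shows "root l (t l) \<le> root k (t k)"
proof -
  \<comment> \<open>\<open>r\<close> is the l^k norm of the family. One term is at most the whole
    sum, so \<open>r\<close> bounds every member, and each of the l - k extra factors costs at most
    \<open>r\<close>.\<close>
  define r where "r = root k (t k)"
  have r: "0 < r" "r ^ k = t k"
    using assms t_pos[of k] by (auto simp: r_def)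
  have "a i \<le> r" if "i \<in> J" for i
    using power_le_t[OF assms(1) that] r assms(1)
    by (metis less_imp_le power_mono_iff nonneg[OF that] zero_less_iff_neq_zero not_one_le_zero)
  then have "t (k + (l - k)) \<le> r ^ (l - k) * t k"
    using assms by (intro t_add_le)
  also have "\<dots> = r ^ l"
    using assms r by (metis le_add_diff_inverse2 power_add)
  finally have "root l (t l) \<le> root l (r ^ l)"
    using assms by simp
  also have "\<dots> = r"
    using assms r(1) by (intro real_root_power_cancel) auto
  finally show ?thesis
    by (simp add: r_def)
qed

lemma le_root_t: "1 \<le> k \<Longrightarrow> a m \<le> root k (t k)"
  using power_le_t[OF _ m_in, of k] m_pos
  by (metis less_imp_le real_root_le_mono real_root_power_cancel One_nat_def Suc_le_lessD)

text \<open>Writing the argument as \<open>b ^ k * (c / b)\<close> splits off \<open>b\<close>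
  exactly, and k-th roots of a positive constant tend to 1. Used with \<open>b\<close> equal to
  \<open>a m\<close> and to the limit of the ratios.\<close>

lemma root_geometric_LIMSEQ:
  assumes "0 < b" "0 < (c::real)"
  shows "(\<lambda>k. root k (b ^ (k - 1) * c)) \<longlonglongrightarrow> b"
proof -
  have "(\<lambda>k. b * root k (c / b)) \<longlonglongrightarrow> b * 1"
    using assms by (intro tendsto_intros LIMSEQ_root_const) auto
  moreover have "\<forall>\<^sub>F k in sequentially. b * root k (c / b) = root k (b ^ (k - 1) * c)"
    using eventually_ge_at_top[of "1::nat"]
  proof eventually_elim
    case (elim k)
    have "b ^ (k - 1) * c = b ^ k * (c / b)"
      using elim assms by (cases k) auto
    then have "root k (b ^ (k - 1) * c) = root k (b ^ k) * root k (c / b)"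
      by (simp only: real_root_mult)
    also have "root k (b ^ k) = b"
      using elim assms by (intro real_root_power_cancel) auto
    finally show ?case ..
  qed
  ultimately show ?thesis
    by (auto intro: Lim_transform_eventually)
qed

text \<open>Squeeze: the single term at \<open>m\<close> bounds \<open>t k\<close> from below, and
  taking k - 1 factors out of \<open>t k\<close> leaves \<open>a m ^ (k - 1) * t 1\<close>
  above.\<close>

lemma root_t_LIMSEQ: "(\<lambda>k. root k (t k)) \<longlonglongrightarrow> a m"
proof (rule real_tendsto_sandwich)
  show "\<forall>\<^sub>F k in sequentially. a m \<le> root k (t k)"
    using eventually_ge_at_top[of "1::nat"] by eventually_elim (rule le_root_t)
  show "\<forall>\<^sub>F k in sequentially. root k (t k) \<le> root k (a m ^ (k - 1) * t 1)"
    using eventually_ge_at_top[of "1::nat"]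
  proof eventually_elim
    case (elim k)
    then show ?case
      using t_add_le[of 1 "a m" "k - 1"] le_m by simp
  qed
  show "(\<lambda>k. root k (a m ^ (k - 1) * t 1)) \<longlonglongrightarrow> a m"
    using m_pos t_pos[of 1] by (intro root_geometric_LIMSEQ) auto
qed simp

section \<open>Ratios of consecutive power sums\<close>

definition ratio :: "nat \<Rightarrow> real" where
  "ratio k = t (Suc k) / t k"

lemma ratio_pos: "1 \<le> k \<Longrightarrow> 0 < ratio k"
  by (simp add: ratio_def t_pos)

lemma ratio_le: "1 \<le> k \<Longrightarrow> ratio k \<le> a m"
  using t_add_le[of k "a m" 1] t_pos[of k] le_m by (simp add: ratio_def divide_le_eq)

text \<open>\<open>ratio k\<close> is the mean of \<open>a\<close> under the weights
  \<open>a i ^ k\<close>. The weighted sum of squared deviations from this mean is nonnegative,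
  which is the log-convexity of \<open>t\<close> at \<open>k\<close>.\<close>

lemma ratio_Suc:
  assumes k: "1 \<le> k"
  shows "ratio k \<le> ratio (Suc k)"
proof -
  define c where "c = ratio k"
  have c: "t (Suc k) = c * t k"
    using t_pos[OF k] by (simp add: c_def ratio_def)
  have s: "(\<lambda>i. a i ^ Suc (Suc k)) summable_on J" "(\<lambda>i. (- 2 * c) * a i ^ Suc k) summable_on J"
    "(\<lambda>i. c\<^sup>2 * a i ^ k) summable_on J"
    using k by (intro summable_on_cmult_right power_summable; simp)+
  have "0 \<le> (\<Sum>\<^sub>\<infinity>i\<in>J. a i ^ k * (a i - c)\<^sup>2)"
    using nonneg by (intro infsum_nonneg) auto
  also have "\<dots> = (\<Sum>\<^sub>\<infinity>i\<in>J. a i ^ Suc (Suc k) + (- 2 * c) * a i ^ Suc k + c\<^sup>2 * a i ^ k)"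
    by (intro infsum_cong) (simp add: power2_eq_square algebra_simps)
  also have "\<dots> = t (Suc (Suc k)) + (- 2 * c) * t (Suc k) + c\<^sup>2 * t k"
    unfolding t_def
    by (subst infsum_add[OF summable_on_add[OF s(1,2)] s(3)], subst infsum_add[OF s(1,2)])
       (simp only: infsum_cmult_right')
  \<comment> \<open>Since \<open>c * t k = t (Suc k)\<close>, the quadratic term cancels half of the
    mixed one.\<close>
  also have "\<dots> = t (Suc (Suc k)) - c * t (Suc k)"
    by (simp add: c power2_eq_square)
  finally show ?thesis
    using t_pos[of "Suc k"] by (simp add: ratio_def[of "Suc k"] c_def[symmetric] le_divide_eq)
qed

text \<open>Monotonicity and \<open>ratio_le\<close> give a limit L at most \<open>a m\<close>. As
  no ratio exceeds L, multiplying them up bounds \<open>t k\<close> by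
  \<open>L ^ (k - 1) * t 1\<close>; k-th roots of both sides then give \<open>a m\<close> <= L in
  the limit.\<close>

lemma ratio_LIMSEQ: "ratio \<longlonglongrightarrow> a m"
proof -
  have "incseq (\<lambda>k. ratio (Suc k))"
    by (intro incseq_SucI ratio_Suc) simp
  then obtain L where L: "(\<lambda>k. ratio (Suc k)) \<longlonglongrightarrow> L" "\<And>k. ratio (Suc k) \<le> L"
    using incseq_convergent[of "\<lambda>k. ratio (Suc k)" "a m"] ratio_le by auto
  have L_pos: "0 < L"
    using L(2)[of 0] ratio_pos[of 1] by simp
  have step: "t (Suc k) \<le> L ^ k * t 1" for k
  proof (induction k)
    case (Suc k)
    have "t (Suc (Suc k)) = ratio (Suc k) * t (Suc k)"
      using t_pos[of "Suc k"] by (simp add: ratio_def)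
    also have "\<dots> \<le> L * (L ^ k * t 1)"
      using Suc L(2)[of k] L_pos t_pos[of "Suc k"] by (intro mult_mono) auto
    finally show ?case by (simp add: mult.assoc)
  qed simp
  have "a m \<le> L"
  proof (rule LIMSEQ_le)
    show "(\<lambda>k. root k (L ^ (k - 1) * t 1)) \<longlonglongrightarrow> L"
      using L_pos t_pos[of 1] by (intro root_geometric_LIMSEQ) auto
    show "\<exists>N. \<forall>k\<ge>N. root k (t k) \<le> root k (L ^ (k - 1) * t 1)"
    proof (intro exI[of _ 1] allI impI)
      fix k :: nat assume "1 \<le> k"
      then show "root k (t k) \<le> root k (L ^ (k - 1) * t 1)"
        using step[of "k - 1"] by simp
    qed
  qed (rule root_t_LIMSEQ)
  moreover have "L \<le> a m"
    using L(1) by (rule LIMSEQ_le_const2) (auto intro!: exI[of _ 0] ratio_le)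
  ultimately show ?thesis
    using L(1) by (simp add: filterlim_sequentially_Suc)
qed

end

section \<open>Eigenvalues of the Markov operator\<close>

lemma probability_density_imp_prob_space:
  assumes "probability_density M \<pi>"
  shows "prob_space (density M (\<lambda>x. ennreal (\<pi> x)))"
  using assms unfolding probability_density_def
  by (intro prob_spaceI) (auto simp: emeasure_density cong: nn_integral_cong)

lemma eigenvalue_multiplicity_ge:
  assumes "\<And>i. i < n \<Longrightarrow> f i \<in> eigenspace M \<pi> T c" "L2_independent M \<pi> n f"
  shows "enat n \<le> eigenvalue_multiplicity M \<pi> T c"
  unfolding eigenvalue_multiplicity_def using assms by (intro Sup_upper) auto

lemma eigenvalue_multiplicity_nonzeroE:
  assumes "eigenvalue_multiplicity M \<pi> T c \<noteq> 0"
  obtains f where "f \<in> eigenspace M \<pi> T c" "\<not> L2_eq M \<pi> f (\<lambda>_. 0)"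
proof -
  have "\<exists>n\<noteq>0. \<exists>f. (\<forall>i<n. f i \<in> eigenspace M \<pi> T c) \<and> L2_independent M \<pi> n f"
  proof (rule ccontr)
    assume *: "\<not> ?thesis"
    have "eigenvalue_multiplicity M \<pi> T c \<le> 0"
      unfolding eigenvalue_multiplicity_def
    proof (rule Sup_least)
      fix e assume "e \<in> {enat n | n. \<exists>f. (\<forall>i<n. f i \<in> eigenspace M \<pi> T c) \<and> L2_independent M \<pi> n f}"
      then obtain n where "e = enat n"
        "\<exists>f. (\<forall>i<n. f i \<in> eigenspace M \<pi> T c) \<and> L2_independent M \<pi> n f"
        by blast
      with * show "e \<le> 0"
        by (cases "n = 0") (simp add: zero_enat_def, blast)
    qed
    then show False using assms by simp
  qed
  then obtain n f where f: "\<forall>i<n. f i \<in> eigenspace M \<pi> T c" "L2_independent M \<pi> n f"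
    and n: "n \<noteq> 0"
    by blast
  have "\<not> L2_eq M \<pi> (f 0) (\<lambda>_. 0)"
  proof
    assume eq: "L2_eq M \<pi> (f 0) (\<lambda>_. 0)"
    \<comment> \<open>These coefficients turn a null \<open>f 0\<close> into a nontrivial linear
      relation.\<close>
    define a :: "nat \<Rightarrow> complex" where "a i = (if i = 0 then 1 else 0)" for i
    have "(\<Sum>i<n. a i * f i x) = f 0 x" for x
      using n by (simp add: a_def if_distrib[where f="\<lambda>c. c * _"] sum.delta cong: if_cong)
    then have "L2_eq M \<pi> (\<lambda>x. \<Sum>i<n. a i * f i x) (\<lambda>_. 0)"
      using eq by simp
    then have "\<forall>i<n. a i = 0"
      using f(2) unfolding L2_independent_def by blast
    then have "a 0 = 0"
      using n by blast
    then show False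
      by (simp add: a_def)
  qed
  then show thesis
    using f n that by blast
qed

text \<open>The constant 1 is fixed because each \<open>p u\<close> integrates to 1. As \<pi> has
  total mass 1, it lies in L2 and a constant that is null almost everywhere is 0.\<close>

lemma one_is_markov_eigenvalue:
  assumes \<pi>: "probability_density M \<pi>" and p: "transition_density M p"
  shows "eigenvalue_multiplicity M \<pi> (markov_op M p) 1 \<noteq> 0"
proof -
  interpret D: prob_space "density M (\<lambda>x. ennreal (\<pi> x))"
    using \<pi> by (rule probability_density_imp_prob_space)
  have [measurable]: "\<pi> \<in> borel_measurable M"
    using \<pi> by (simp add: probability_density_def)
  have int: "integrable M \<pi>"
    using \<pi> unfolding probability_density_def
    by (intro integrableI_nn_integral_finite[where x=1]) auto
  have one: "markov_op M p (\<lambda>_. 1) u = 1" if u: "u \<in> space M" for u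
  proof -
    have "probability_density M (p u)"
      using p u by (simp add: transition_density_def)
    then have "has_bochner_integral M (p u) 1"
      unfolding probability_density_def by (intro has_bochner_integral_nn_integral) auto
    then show ?thesis
      by (simp add: markov_op_def has_bochner_integral_integral_eq)
  qed
  have "(\<lambda>_. 1) \<in> eigenspace M \<pi> (markov_op M p) 1"
    using int one by (auto simp: eigenspace_def L2_def L2_eq_def intro!: AE_I2)
  moreover have "L2_independent M \<pi> 1 (\<lambda>_ _. 1)"
    by (auto simp: L2_independent_def L2_eq_def D.AE_const)
  ultimately have "enat 1 \<le> eigenvalue_multiplicity M \<pi> (markov_op M p) 1"
    by (intro eigenvalue_multiplicity_ge) auto
  then show ?thesis
    by (auto simp: enat_0_iff)
qed

section \<open>Contraction in L1 and the bound on positive eigenvalues\<close>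

lemma norm_markov_op_le:
  "ennreal (cmod (markov_op M p f u)) \<le> (\<integral>\<^sup>+v. ennreal (cmod (complex_of_real (p u v) * f v)) \<partial>M)"
  unfolding markov_op_def
  \<comment> \<open>If the integrand is not integrable, the Bochner integral defaults to 0 and the
    bound is trivial.\<close>
  by (cases "integrable M (\<lambda>v. complex_of_real (p u v) * f v)")
     (auto simp: not_integrable_integral_eq intro: integral_norm_bound_ennreal)

text \<open>Move the modulus inside, exchange the integrals by Tonelli, and integrate out
  \<open>u\<close>: by invariance \<open>\<pi> u * p u v\<close> integrates to
  \<open>\<pi> v\<close> for almost every \<open>v\<close>.\<close>

lemma nn_integral_markov_op_le:
  assumes M: "sigma_finite_measure M" and p: "transition_density M p"
    and inv: "invariant_density M p \<pi>" and [measurable]: "f \<in> borel_measurable M"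
  shows "(\<integral>\<^sup>+u. ennreal (\<pi> u) * ennreal (cmod (markov_op M p f u)) \<partial>M)
       \<le> (\<integral>\<^sup>+v. ennreal (\<pi> v) * ennreal (cmod (f v)) \<partial>M)"
proof -
  interpret sigma_finite_measure M by fact
  interpret pair_sigma_finite M M ..
  have [measurable]: "(\<lambda>(x, y). p x y) \<in> borel_measurable (M \<Otimes>\<^sub>M M)" "\<pi> \<in> borel_measurable M"
    using p inv by (auto simp: transition_density_def invariant_density_def probability_density_def)
  have p_nn: "0 \<le> p u v" if "u \<in> space M" "v \<in> space M" for u v
    using p that by (auto simp: transition_density_def probability_density_def)
  have \<pi>_nn: "0 \<le> \<pi> u" if "u \<in> space M" for u
    using inv that by (auto simp: invariant_density_def probability_density_def)
  have "(\<integral>\<^sup>+u. ennreal (\<pi> u) * ennreal (cmod (markov_op M p f u)) \<partial>M)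
      \<le> (\<integral>\<^sup>+u. ennreal (\<pi> u) * (\<integral>\<^sup>+v. ennreal (cmod (complex_of_real (p u v) * f v)) \<partial>M) \<partial>M)"
    by (intro nn_integral_mono mult_left_mono norm_markov_op_le) simp
  also have "\<dots> = (\<integral>\<^sup>+u. \<integral>\<^sup>+v. ennreal (\<pi> u * p u v) * ennreal (cmod (f v)) \<partial>M \<partial>M)"
    by (intro nn_integral_cong, subst nn_integral_cmult[symmetric])
       (auto intro!: nn_integral_cong simp: norm_mult p_nn \<pi>_nn ennreal_mult' ennreal_mult'' mult.assoc)
  also have "\<dots> = (\<integral>\<^sup>+v. \<integral>\<^sup>+u. ennreal (\<pi> u * p u v) * ennreal (cmod (f v)) \<partial>M \<partial>M)"
    by (rule Fubini'[symmetric]) measurable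
  also have "\<dots> = (\<integral>\<^sup>+v. (\<integral>\<^sup>+u. ennreal (\<pi> u * p u v) \<partial>M) * ennreal (cmod (f v)) \<partial>M)"
    by (intro nn_integral_cong nn_integral_multc) measurable
  also have "\<dots> = (\<integral>\<^sup>+v. ennreal (\<pi> v) * ennreal (cmod (f v)) \<partial>M)"
    using inv by (intro nn_integral_cong_AE) (auto simp: invariant_density_def)
  finally show ?thesis .
qed

text \<open>Since |f| <= 1 + |f|^2 pointwise, the integral is at most the mass of \<pi> plus the
  squared L2 norm.\<close>

lemma L2_nn_integral_finite:
  assumes \<pi>: "probability_density M \<pi>" and f: "f \<in> L2 M \<pi>"
  shows "(\<integral>\<^sup>+v. ennreal (\<pi> v) * ennreal (cmod (f v)) \<partial>M) < \<infinity>"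
proof -
  have [measurable]: "\<pi> \<in> borel_measurable M" "f \<in> borel_measurable M"
    using \<pi> f by (auto simp: probability_density_def L2_def)
  have \<pi>_nn: "0 \<le> \<pi> u" if "u \<in> space M" for u
    using \<pi> that by (auto simp: probability_density_def)
  have "(\<integral>\<^sup>+v. ennreal (\<pi> v) * ennreal (cmod (f v)) \<partial>M)
      \<le> (\<integral>\<^sup>+v. ennreal (\<pi> v) + ennreal ((cmod (f v))\<^sup>2 * \<pi> v) \<partial>M)"
  proof (rule nn_integral_mono)
    fix v assume v: "v \<in> space M"
    have "cmod (f v) \<le> 1 + (cmod (f v))\<^sup>2"
      using sum_squares_bound[of "cmod (f v)" 1] norm_ge_zero[of "f v"]
      unfolding power_one mult_1_right by linarith
    then have "\<pi> v * cmod (f v) \<le> \<pi> v + (cmod (f v))\<^sup>2 * \<pi> v"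
      using mult_left_mono[OF _ \<pi>_nn[OF v]] by (fastforce simp: algebra_simps)
    then show "ennreal (\<pi> v) * ennreal (cmod (f v)) \<le> ennreal (\<pi> v) + ennreal ((cmod (f v))\<^sup>2 * \<pi> v)"
      using \<pi>_nn[OF v] by (simp flip: ennreal_mult ennreal_plus)
  qed
  also have "\<dots> = (\<integral>\<^sup>+v. ennreal (\<pi> v) \<partial>M) + (\<integral>\<^sup>+v. ennreal ((cmod (f v))\<^sup>2 * \<pi> v) \<partial>M)"
    by (intro nn_integral_add) measurable
  also have "\<dots> < \<infinity>"
  proof -
    have "(\<integral>\<^sup>+v. ennreal ((cmod (f v))\<^sup>2 * \<pi> v) \<partial>M) = ennreal (\<integral>v. (cmod (f v))\<^sup>2 * \<pi> v \<partial>M)"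
      using f \<pi>_nn by (intro nn_integral_eq_integral) (auto simp: L2_def intro!: AE_I2)
    then show ?thesis
      using \<pi> by (simp add: probability_density_def)
  qed
  finally show ?thesis .
qed

text \<open>Integrating |Pf| = x |f| against \<pi>, contraction gives x I <= I. Here I is finite
  because f is in L2 and nonzero because f is not null, so I cancels.\<close>

lemma markov_eigenvalue_le_one:
  assumes M: "sigma_finite_measure M" and p: "transition_density M p"
    and inv: "invariant_density M p \<pi>" and x: "0 < x"
    and mult: "eigenvalue_multiplicity M \<pi> (markov_op M p) (complex_of_real x) \<noteq> 0"
  shows "x \<le> 1"
proof -
  have \<pi>: "probability_density M \<pi>"
    using inv by (simp add: invariant_density_def)
  then have [measurable]: "\<pi> \<in> borel_measurable M"
    by (simp add: probability_density_def)
  obtain f where f: "f \<in> eigenspace M \<pi> (markov_op M p) (complex_of_real x)"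
    and nz: "\<not> L2_eq M \<pi> f (\<lambda>_. 0)"
    using mult by (rule eigenvalue_multiplicity_nonzeroE)
  have fL2: "f \<in> L2 M \<pi>" and eq: "AE u in M. 0 < ennreal (\<pi> u) \<longrightarrow> markov_op M p f u = complex_of_real x * f u"
    using f by (auto simp: eigenspace_def L2_eq_def AE_density)
  have [measurable]: "f \<in> borel_measurable M"
    using fL2 by (simp add: L2_def)
  define I where "I = (\<integral>\<^sup>+v. ennreal (\<pi> v) * ennreal (cmod (f v)) \<partial>M)"
  have "ennreal x * I = (\<integral>\<^sup>+u. ennreal x * (ennreal (\<pi> u) * ennreal (cmod (f u))) \<partial>M)"
    unfolding I_def by (rule nn_integral_cmult[symmetric]) measurable
  also have "\<dots> = (\<integral>\<^sup>+u. ennreal (\<pi> u) * ennreal (cmod (markov_op M p f u)) \<partial>M)"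
  proof (rule nn_integral_cong_AE)
    show "AE u in M. ennreal x * (ennreal (\<pi> u) * ennreal (cmod (f u))) =
        ennreal (\<pi> u) * ennreal (cmod (markov_op M p f u))"
      using eq
    proof eventually_elim
      case (elim u)
      show ?case
      \<comment> \<open>The eigenvalue equation is only available where \<pi> is positive; elsewhere
        the weight makes both sides 0.\<close>
      proof (cases "0 < ennreal (\<pi> u)")
        case True
        then show ?thesis
          using elim x by (simp add: norm_mult ennreal_mult' mult_ac)
      next
        case False
        then show ?thesis by (simp only: not_less le_zero_eq) simp
      qed
    qed
  qed
  also have "\<dots> \<le> I"
    unfolding I_def using M p inv by (rule nn_integral_markov_op_le) measurable
  finally have le: "ennreal x * I \<le> I" .
  have fin: "I < \<infinity>"
    unfolding I_def using \<pi> fL2 by (rule L2_nn_integral_finite)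
  have "I \<noteq> 0"
  proof
    assume "I = 0"
    then have "AE v in M. ennreal (\<pi> v) * ennreal (cmod (f v)) = 0"
      unfolding I_def by (subst (asm) nn_integral_0_iff_AE) auto
    then have "L2_eq M \<pi> f (\<lambda>_. 0)"
      by (auto simp: L2_eq_def AE_density elim!: eventually_mono)
    then show False using nz by simp
  qed
  then obtain r where "I = ennreal r" "0 < r"
    using fin by (cases I) (auto simp: less_le)
  then show ?thesis
    using le x by (simp flip: ennreal_mult add: ennreal_le_iff)
qed

section \<open>Leading value and summability of the enumerated eigenvalues\<close>

lemma enumerated_eigenvalue_iff:
  assumes "enumerates_positive_eigenvalues M \<pi> T \<kappa> lam" "0 < x"
  shows "eigenvalue_multiplicity M \<pi> T (complex_of_real x) \<noteq> 0 \<longleftrightarrow> (\<exists>i. enat i \<le> \<kappa> \<and> lam i = x)"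
  using assms unfolding enumerates_positive_eigenvalues_def by (auto simp: enat_0_iff card_eq_0_iff)

lemma markov_leading_eigenvalue:
  assumes M: "sigma_finite_measure M" and \<pi>: "probability_density M \<pi>" and p: "transition_density M p"
    and inv: "invariant_density M p \<pi>"
    and lam: "enumerates_positive_eigenvalues M \<pi> (markov_op M p) \<kappa> lam"
  shows "lam 0 = 1"
proof -
  have pos: "0 < lam 0"
    using lam by (auto simp: enumerates_positive_eigenvalues_def zero_enat_def[symmetric])
  then have "eigenvalue_multiplicity M \<pi> (markov_op M p) (complex_of_real (lam 0)) \<noteq> 0"
    by (subst enumerated_eigenvalue_iff[OF lam]) (auto simp: zero_enat_def[symmetric] intro!: exI[of _ 0])
  then have "lam 0 \<le> 1"
    using M p inv pos by (intro markov_eigenvalue_le_one)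
  moreover obtain i where "enat i \<le> \<kappa>" "lam i = 1"
    using enumerated_eigenvalue_iff[OF lam, of 1] one_is_markov_eigenvalue[OF \<pi> p] by auto
  then have "1 \<le> lam 0"
    using lam unfolding enumerates_positive_eigenvalues_def by (metis le0)
  ultimately show ?thesis by simp
qed

text \<open>A finite partial sum is grouped by eigenvalue. Each group has at most as many indices as
  the multiplicity, so the finite trace series bounds all partial sums.\<close>

lemma trace_class_eigenvalues_summable:
  assumes tc: "trace_class_op M \<pi> T" and lam: "enumerates_positive_eigenvalues M \<pi> T \<kappa> lam"
  shows "lam summable_on {i. enat i \<le> \<kappa>}"
proof -
  define w where "w c = ennreal_of_enat (eigenvalue_multiplicity M \<pi> T c) * ennreal (cmod c)" for c
  have pos: "0 < lam i" if "enat i \<le> \<kappa>" for i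
    using lam that by (auto simp: enumerates_positive_eigenvalues_def)
  have fin: "infsum w UNIV < \<infinity>"
    using tc unfolding trace_class_op_def w_def by simp
  have bound: "ennreal (sum lam F) \<le> infsum w UNIV" if F: "finite F" "F \<subseteq> {i. enat i \<le> \<kappa>}" for F
  proof -
    have "ennreal (sum lam F) = (\<Sum>i\<in>F. ennreal (lam i))"
      using F pos by (subst sum_ennreal) (auto simp: less_imp_le)
    also have "\<dots> = (\<Sum>x\<in>lam ` F. \<Sum>i\<in>{i\<in>F. lam i = x}. ennreal (lam i))"
      using F(1) by (rule sum.image_gen)
    also have "\<dots> \<le> (\<Sum>x\<in>lam ` F. w (complex_of_real x))"
    proof (rule sum_mono)
      fix x assume "x \<in> lam ` F"
      then have x: "0 < x"
        using F pos by auto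
      have A: "finite {i. enat i \<le> \<kappa> \<and> lam i = x}"
        "eigenvalue_multiplicity M \<pi> T (complex_of_real x) = enat (card {i. enat i \<le> \<kappa> \<and> lam i = x})"
        using lam x by (auto simp: enumerates_positive_eigenvalues_def)
      have "(\<Sum>i\<in>{i\<in>F. lam i = x}. ennreal (lam i)) = of_nat (card {i\<in>F. lam i = x}) * ennreal x"
        by simp
      also have "\<dots> \<le> of_nat (card {i. enat i \<le> \<kappa> \<and> lam i = x}) * ennreal x"
        using F by (intro mult_right_mono of_nat_mono card_mono A(1)) auto
      also have "\<dots> = w (complex_of_real x)"
        using x by (simp add: w_def A(2))
      finally show "(\<Sum>i\<in>{i\<in>F. lam i = x}. ennreal (lam i)) \<le> w (complex_of_real x)" .
    qed
    also have "\<dots> = sum w (complex_of_real ` lam ` F)"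
      by (subst sum.reindex) (auto intro: inj_onI)
    also have "\<dots> = infsum w (complex_of_real ` lam ` F)"
      using F by simp
    also have "\<dots> \<le> infsum w UNIV"
      by (intro infsum_mono_neutral nonneg_summable_on_complete) auto
    finally show ?thesis .
  qed
  show ?thesis
  proof (rule nonneg_bdd_above_summable_on)
    show "0 \<le> lam i" if "i \<in> {i. enat i \<le> \<kappa>}" for i
      using pos[of i] that by simp
    show "bdd_above (sum lam ` {F. F \<subseteq> {i. enat i \<le> \<kappa>} \<and> finite F})"
    proof (rule bdd_aboveI2)
      fix F assume "F \<in> {F. F \<subseteq> {i. enat i \<le> \<kappa>} \<and> finite F}"
      then have "ennreal (sum lam F) \<le> ennreal (enn2real (infsum w UNIV))"
        using bound[of F] fin by simp
      then show "sum lam F \<le> enn2real (infsum w UNIV)"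
        by (subst (asm) ennreal_le_iff) auto
    qed
  qed
qed

section \<open>From extended-real power sums to real ones\<close>

lemma has_sum_ereal:
  assumes "(f has_sum s) A"
  shows "((\<lambda>i. ereal (f i)) has_sum ereal s) A"
proof -
  have "((\<lambda>F. ereal (sum f F)) \<longlongrightarrow> ereal s) (finite_subsets_at_top A)"
    using assms by (simp add: has_sum_def)
  moreover have "(\<lambda>F. ereal (sum f F)) = sum (\<lambda>i. ereal (f i))"
    by (rule ext) (rule sum_ereal[symmetric])
  ultimately show ?thesis
    by (simp only: has_sum_def)
qed

text \<open>Subtracting 1 removes exactly the term of index 0. This also covers \<kappa> = 0, where
  the remaining index set is empty.\<close>

lemma power_sum_minus_one:
  assumes lam0: "lam 0 = 1" and k: "1 \<le> k"
    and sum: "(\<lambda>i. lam i ^ k) summable_on ({i. enat i \<le> \<kappa>} - {0})"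
  shows "power_sum \<kappa> lam k - 1 = ereal (\<Sum>\<^sub>\<infinity>i\<in>{i. enat i \<le> \<kappa>} - {0}. lam i ^ k)"
proof -
  define s where "s = (\<Sum>\<^sub>\<infinity>i\<in>{i. enat i \<le> \<kappa>} - {0}. lam i ^ k)"
  have "((\<lambda>i. lam i ^ k) has_sum (lam 0 ^ k + s)) (insert 0 ({i. enat i \<le> \<kappa>} - {0}))"
    using sum by (intro has_sum_insert) (auto simp: s_def)
  also have "insert 0 ({i. enat i \<le> \<kappa>} - {0}) = {i. enat i \<le> \<kappa>}"
    by (auto simp: zero_enat_def[symmetric])
  finally have "((\<lambda>i. ereal (lam i ^ k)) has_sum ereal (1 + s)) {i. enat i \<le> \<kappa>}"
    using lam0 by (intro has_sum_ereal) simp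
  then have "power_sum \<kappa> lam k = ereal (1 + s)"
    using k by (simp add: power_sum_def infsumI)
  then show ?thesis
    by (simp add: s_def one_ereal_def)
qed

theorem proposition1:
  fixes M :: "'a measure" and \<pi> :: "'a \<Rightarrow> real" and p :: "'a \<Rightarrow> 'a \<Rightarrow> real"
    and \<kappa> :: enat and lam :: "nat \<Rightarrow> real"
  assumes "sigma_finite_measure M"
    and "countably_generated M"
    and "probability_density M \<pi>"
    and "transition_density M p"
    and "invariant_density M p \<pi>"
    and "harris_ergodic M p"
    and "nonneg_op M \<pi> (markov_op M p)"
    and "trace_class_op M \<pi> (markov_op M p)"
    and "enumerates_positive_eigenvalues M \<pi> (markov_op M p) \<kappa> lam"
  shows "antimono_on {1..} (upper_bound_seq \<kappa> lam) \<and>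
         upper_bound_seq \<kappa> lam \<longlonglongrightarrow> lambda_one \<kappa> lam \<and>
         (\<kappa> \<ge> 1 \<longrightarrow>
            mono_on {1..} (lower_bound_seq \<kappa> lam) \<and>
            lower_bound_seq \<kappa> lam \<longlonglongrightarrow> lambda_one \<kappa> lam)"
proof -
  define J where "J = {i. enat i \<le> \<kappa>} - {0}"
  have lam0: "lam 0 = 1"
    using assms by (intro markov_leading_eigenvalue)
  have pos: "0 < lam i" if "enat i \<le> \<kappa>" for i
    using assms(9) that by (auto simp: enumerates_positive_eigenvalues_def)
  have dec: "lam j \<le> lam i" if "i \<le> j" "enat j \<le> \<kappa>" for i j
    using assms(9) that by (auto simp: enumerates_positive_eigenvalues_def)
  show ?thesis
  proof (cases "\<kappa> = 0")
    case True
    then have "J = {}"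
      by (auto simp: J_def zero_enat_def)
    \<comment> \<open>For k >= 1 the remaining sum is empty; at k = 0 the value comes from the
      convention that \<open>root 0\<close> is 0.\<close>
    then have "upper_bound_seq \<kappa> lam k = 0" for k
      using power_sum_minus_one[of lam k \<kappa>, folded J_def] lam0
      by (cases "k = 0") (auto simp: upper_bound_seq_def)
    then have "upper_bound_seq \<kappa> lam = (\<lambda>_. 0)"
      by (rule ext)
    then show ?thesis
      using True by (simp add: lambda_one_def monotone_on_def)
  next
    case False
    then have \<kappa>: "enat 1 \<le> \<kappa>"
      by (cases \<kappa>) (auto simp: zero_enat_def)
    interpret dominated_summable_family lam J 1
    proof
      show "lam summable_on J"
        using trace_class_eigenvalues_summable[OF assms(8,9)]
        by (rule summable_on_subset) (auto simp: J_def)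
      show "lam i \<le> lam 1" "0 \<le> lam i" if "i \<in> J" for i
        using that dec[of 1 i] pos[of i] by (auto simp: J_def)
    qed (use \<kappa> pos[of 1] in \<open>auto simp: J_def\<close>)
    have s: "power_sum \<kappa> lam k - 1 = ereal (t k)" if "1 \<le> k" for k
      using power_sum_minus_one[of lam k \<kappa>, folded J_def] lam0 that power_summable[OF that] by (simp add: t_def)
    have l1: "lambda_one \<kappa> lam = lam 1"
      using False by (simp add: lambda_one_def)
    have u: "upper_bound_seq \<kappa> lam k = root k (t k)" if "1 \<le> k" for k
      using s[OF that] by (simp add: upper_bound_seq_def)
    \<comment> \<open>A finite number divided by infinity is 0 in \<open>ereal\<close>, so the
      convention for index 0 yields the first lower bound.\<close>
    have l_one: "lower_bound_seq \<kappa> lam 1 = 0"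
      using s[of 1] by (simp add: lower_bound_seq_def power_sum_def)
    have l: "lower_bound_seq \<kappa> lam (Suc k) = ratio k" if "1 \<le> k" for k
      using s[of "Suc k"] s[OF that] t_pos[OF that]
      by (simp add: lower_bound_seq_def ratio_def)
    have "antimono_on {1..} (upper_bound_seq \<kappa> lam)"
      by (auto simp: monotone_on_def u root_t_antimono)
    moreover have "upper_bound_seq \<kappa> lam \<longlonglongrightarrow> lam 1"
      using root_t_LIMSEQ
      by (rule Lim_transform_eventually) (use u in \<open>auto simp: eventually_sequentially intro!: exI[of _ 1]\<close>)
    moreover have "mono_on {1..} (lower_bound_seq \<kappa> lam)"
    proof -
      \<comment> \<open>The first comparison is 0 against a positive ratio; the later ones are
        \<open>ratio_Suc\<close>, with indices shifted by one.\<close>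
      have "lower_bound_seq \<kappa> lam (Suc k) \<le> lower_bound_seq \<kappa> lam (Suc (Suc k))" for k
      proof (cases k)
        case 0
        then show ?thesis
          using l[of 1] l_one ratio_pos[of 1] by simp
      next
        case (Suc n)
        then show ?thesis
          using l[of k] l[of "Suc k"] ratio_Suc[of k] by simp
      qed
      then have "incseq (\<lambda>k. lower_bound_seq \<kappa> lam (Suc k))"
        by (rule incseq_SucI)
      \<comment> \<open>On indices from 1 on, \<open>Suc (i - 1)\<close> is \<open>i\<close>, which
        undoes the shift.\<close>
      then have "lower_bound_seq \<kappa> lam (Suc (i - 1)) \<le> lower_bound_seq \<kappa> lam (Suc (j - 1))"
        if "i \<le> j" for i j
        by (rule incseqD) (use that in simp)
      then show ?thesis
        by (fastforce simp: monotone_on_def)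
    qed
    moreover have "lower_bound_seq \<kappa> lam \<longlonglongrightarrow> lam 1"
    proof -
      have "(\<lambda>k. lower_bound_seq \<kappa> lam (Suc k)) \<longlonglongrightarrow> lam 1"
        using ratio_LIMSEQ
        by (rule Lim_transform_eventually) (use l in \<open>auto simp: eventually_sequentially intro!: exI[of _ 1]\<close>)
      then show ?thesis
        by (rule LIMSEQ_imp_Suc)
    qed
    ultimately show ?thesis
      unfolding l1 by blast
  qed
qed

end
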